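(* Let $A\in\mathbb{C}^{n\times n}$, let $\nu=\operatorname{ind}A$, and let $u\ge\nu$ be an integer. Let $\varphi(\lambda)$ be any nonzero annihilating polynomial of $A^u$ (that is, a complex polynomial, not identically zero, with $\varphi(A^u)=0$), written in the form $$\varphi(\lambda)=\lambda^t(\lambda^q+p_1\lambda^{q-1}+\ldots+p_q),$$ where $t,q\in\{0,1,\ldots\}$, $p_1,\ldots,p_q\in\mathbb{C}$, and the constant term of the polynomial in parentheses, $p_q$, is nonzero. Put $$h(\lambda)=p_q^{-1}(\lambda^q+p_1\lambda^{q-1}+\ldots+p_q).$$ Then the matrix $Z=h(A^u)$ is the eigenprojection of $A$.
   Context: For a square matrix $A\in\mathbb{C}^{n\times n}$, $\mathcal{R}(A)$ and $\mathcal{N}(A)$ denote its range and null space. The index $\operatorname{ind}A$ is the smallest $k\in\{0,1,\ldots\}$ such that $\operatorname{rank}A^{k+1}=\operatorname{rank}A^k$ (with $A^0=I$). The eigenprojection of $A$ (corresponding to the eigenvalue $0$) is the unique idempotent matrix $Z\in\mathbb{C}^{n\times n}$ with $\mathcal{R}(Z)=\mathcal{N}(A^\nu)$ and $\mathcal{N}(Z)=\mathcal{R}(A^\nu)$, where $\nu=\operatorname{ind}A$. The polynomial $\varphi$ is taken to be monic, as the displayed form shows. When $q=0$, the polynomial in parentheses is the constant $1$, so its constant term is $p_0=1$ and $h\equiv1$. *)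

theory Defs
  imports "HOL-Analysis.Analysis" "HOL-Computational_Algebra.Polynomial"
begin

text \<open>On \<open>complex^'n^'n\<close> the overloaded \<open>*\<close> and \<open>^\<close> act entrywise, so powers
  with respect to the matrix product \<open>**\<close> need their own function.\<close>

primrec matrix_power :: "'a::semiring_1^'n^'n \<Rightarrow> nat \<Rightarrow> 'a^'n^'n" where
  "matrix_power A 0 = mat 1"
| "matrix_power A (Suc k) = A ** matrix_power A k"

definition poly_matrix :: "'a::comm_semiring_1 poly \<Rightarrow> 'a^'n^'n \<Rightarrow> 'a^'n^'n" where
  "poly_matrix p A = (\<Sum>k\<le>degree p. map_matrix ((*) (coeff p k)) (matrix_power A k))"

definition matrix_range :: "'a::semiring_1^'n^'m \<Rightarrow> ('a^'m) set" where
  "matrix_range A = range (\<lambda>x. A *v x)"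

definition null_space :: "'a::semiring_1^'n^'m \<Rightarrow> ('a^'n) set" where
  "null_space A = {x. A *v x = 0}"

definition matrix_index :: "'a::field^'n^'n \<Rightarrow> nat" where
  "matrix_index A = (LEAST k. rank (matrix_power A (Suc k)) = rank (matrix_power A k))"

definition is_eigenprojection :: "complex^'n^'n \<Rightarrow> complex^'n^'n \<Rightarrow> bool" where
  "is_eigenprojection A Z \<longleftrightarrow>
     Z ** Z = Z \<and>
     matrix_range Z = null_space (matrix_power A (matrix_index A)) \<and>
     null_space Z = matrix_range (matrix_power A (matrix_index A))"

text \<open>At most one matrix satisfies the predicate, so it does express being
  \<^emph>\<open>the\<close> eigenprojection.\<close>

lemma is_eigenprojection_unique:
  assumes "is_eigenprojection A Z" and "is_eigenprojection A Z'"
  shows "Z = Z'"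
proof -
  have idem: "Z ** Z = Z" "Z' ** Z' = Z'"
    and R: "matrix_range Z = matrix_range Z'"
    and N: "null_space Z = null_space Z'"
    using assms by (simp_all add: is_eigenprojection_def)
  have "Z *v x = Z' *v x" for x
  proof -
    have "Z *v x \<in> matrix_range Z'"
      using R by (auto simp: matrix_range_def)
    then obtain y where y: "Z *v x = Z' *v y"
      by (auto simp: matrix_range_def)
    have fixed: "Z' *v (Z *v x) = Z *v x"
      by (simp add: y matrix_vector_mul_assoc idem)
    have "x - Z *v x \<in> null_space Z"
      by (simp add: null_space_def matrix_vector_mult_diff_distrib matrix_vector_mul_assoc idem)
    then have "Z' *v (x - Z *v x) = 0"
      by (simp add: N) (simp add: null_space_def)
    then show ?thesis
      by (simp add: matrix_vector_mult_diff_distrib fixed)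
  qed
  then show ?thesis
    by (simp add: matrix_eq)
qed

end

theory Submission
  imports Defs
begin

text \<open>
  Write \<open>B = A\<^sup>u\<close>, \<open>\<nu> = ind A\<close>, \<open>Z = h(B)\<close>. Three facts about these matrices carry the
  whole proof.

  \<^item> The constant term of \<open>h\<close> is \<open>1\<close>, so \<open>h(\<lambda>) = 1 + \<lambda> g(\<lambda>)\<close> and \<open>Z = I + B g(B)\<close>.
  \<^item> Since \<open>\<lambda>\<^sup>t h(\<lambda>)\<close> is a scalar multiple of \<open>\<phi>(\<lambda>)\<close>, one has \<open>B\<^sup>t Z = 0\<close>, that is,
    \<open>A\<^sup>u\<^sup>t Z = 0\<close>.
  \<^item> The null space of every power of \<open>A\<close> lies in that of \<open>A\<^sup>\<nu>\<close>
    (lemma \<open>null_space_matrix_power_subset\<close>). This is the only place where the definition of the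
    index enters.

  The last two facts give \<open>A\<^sup>\<nu> Z = 0\<close>, so the range of \<open>Z\<close> lies in the null space of \<open>A\<^sup>\<nu>\<close>;
  as \<open>Z\<close> commutes with \<open>A\<^sup>\<nu>\<close>, the range of \<open>A\<^sup>\<nu>\<close> lies in the null space of \<open>Z\<close>. The opposite
  inclusions come from the first fact together with \<open>u \<ge> \<nu>\<close>. If \<open>A\<^sup>\<nu> x = 0\<close> then \<open>B x = 0\<close>
  and \<open>Z x = x\<close>; this also makes \<open>Z\<close> idempotent. If \<open>Z x = 0\<close> then \<open>x = - B g(B) x\<close> is in the
  range of \<open>B\<close>, hence in that of \<open>A\<^sup>\<nu>\<close>.
\<close>

lemma matrix_power_add: "matrix_power A (m + n) = matrix_power A m ** matrix_power A n"
  by (induction m) (simp_all add: matrix_mul_assoc)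

lemma matrix_power_mult: "matrix_power (matrix_power A m) n = matrix_power A (m * n)"
  by (induction n) (simp_all add: matrix_power_add)

lemma rows_mult_subset_span: "rows (M ** N) \<subseteq> vec.span (rows N)"
  for M :: "'a::field^'m^'l" and N :: "'a^'n^'m"
proof -
  have "row i (M ** N) = (\<Sum>j\<in>UNIV. M $ i $ j *s row j N)" for i
    by (simp add: vec_eq_iff row_def matrix_matrix_mult_def)
  moreover have "row j N \<in> vec.span (rows N)" for j
    by (rule vec.span_base) (auto simp: rows_def)
  ultimately have "row i (M ** N) \<in> vec.span (rows N)" for i
    by (auto intro!: vec.span_sum vec.span_scale)
  then show ?thesis
    by (auto simp: rows_def)
qed

text \<open>The null space of a matrix is the annihilator of its row space.\<close>

lemma null_space_antimono_rows:
  fixes M :: "'a::field^'n^'m" and N :: "'a^'n^'l"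
  assumes "rows N \<subseteq> vec.span (rows M)"
  shows "null_space M \<subseteq> null_space N"
proof
  fix x assume "x \<in> null_space M"
  then have M: "(\<Sum>j\<in>UNIV. M $ i $ j * x $ j) = 0" for i
    by (auto simp: null_space_def matrix_vector_mult_def vec_eq_iff)
  have "(\<Sum>j\<in>UNIV. v $ j * x $ j) = 0" if "v \<in> vec.span (rows M)" for v
    using that
  proof (induction rule: vec.span_induct_alt)
    case base
    show ?case by simp
  next
    case (step c v w)
    from step(1) have "(\<Sum>j\<in>UNIV. v $ j * x $ j) = 0"
      using M by (auto simp: rows_def row_def)
    with step(2) show ?case
      by (simp add: algebra_simps sum.distrib flip: sum_distrib_left)
  qed
  moreover have "row i N \<in> vec.span (rows M)" for i
    using assms by (auto simp: rows_def)
  ultimately have "(\<Sum>j\<in>UNIV. row i N $ j * x $ j) = 0" for i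
    by blast
  then show "x \<in> null_space N"
    by (simp add: null_space_def matrix_vector_mult_def vec_eq_iff row_def)
qed

lemma rank_mult_le_right_field: "rank (M ** N) \<le> rank N"
  for M :: "'a::field^'m^'l" and N :: "'a^'n^'m"
  unfolding row_rank_def_gen using rows_mult_subset_span by (rule vec.dim_mono)

text \<open>The index is well defined: a power of smallest rank attains the required equality.\<close>

lemma rank_matrix_index:
  "rank (matrix_power A (Suc (matrix_index A))) = rank (matrix_power A (matrix_index A))"
  unfolding matrix_index_def
proof (rule LeastI_ex)
  obtain k where "\<And>m. rank (matrix_power A k) \<le> rank (matrix_power A m)"
    using ex_has_least_nat[of "\<lambda>_. True" _ "\<lambda>k. rank (matrix_power A k)"] by blast
  then show "\<exists>k. rank (matrix_power A (Suc k)) = rank (matrix_power A k)"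
    by (metis matrix_power.simps(2) rank_mult_le_right_field antisym)
qed

text \<open>Passing from \<open>A\<^sup>\<nu>\<close> to \<open>A\<^sup>\<nu>\<^sup>+\<^sup>1\<close> can only shrink the row space, and equality of the
  ranks prevents it from shrinking.\<close>

lemma null_space_Suc_matrix_index:
  "null_space (matrix_power A (Suc (matrix_index A))) \<subseteq> null_space (matrix_power A (matrix_index A))"
proof (rule null_space_antimono_rows)
  let ?M = "matrix_power A (matrix_index A)" and ?N = "matrix_power A (Suc (matrix_index A))"
  have "vec.span (rows ?N) = vec.span (rows ?M)"
  proof (rule vec.subspace_dim_equal)
    show "vec.span (rows ?N) \<subseteq> vec.span (rows ?M)"
      using rows_mult_subset_span[of A ?M] by (simp add: vec.span_minimal)
    show "vec.dim (vec.span (rows ?M)) \<le> vec.dim (vec.span (rows ?N))"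
      using rank_matrix_index[of A] by (simp only: row_rank_def_gen vec.dim_span order.refl)
  qed auto
  then show "rows ?M \<subseteq> vec.span (rows ?N)"
    by (simp only: vec.span_superset)
qed

lemma null_space_matrix_power_mono:
  assumes "m \<le> n"
  shows "null_space (matrix_power A m) \<subseteq> null_space (matrix_power A n)"
proof -
  have "matrix_power A n = matrix_power A (n - m) ** matrix_power A m"
    using assms by (simp flip: matrix_power_add)
  then show ?thesis
    by (auto simp: null_space_def simp flip: matrix_vector_mul_assoc)
qed

text \<open>Once two consecutive null spaces agree, all later ones do: if \<open>A\<^sup>\<nu>\<^sup>+\<^sup>1\<close> kills
  \<open>A\<^sup>j x\<close>, then so does \<open>A\<^sup>\<nu>\<close>.\<close>

lemma null_space_matrix_power_subset:
  "null_space (matrix_power A m) \<subseteq> null_space (matrix_power A (matrix_index A))"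
proof -
  let ?\<nu> = "matrix_index A"
  have "null_space (matrix_power A (?\<nu> + j)) \<subseteq> null_space (matrix_power A ?\<nu>)" for j
  proof (induction j)
    case (Suc j)
    have "x \<in> null_space (matrix_power A (?\<nu> + j))"
      if "x \<in> null_space (matrix_power A (?\<nu> + Suc j))" for x
    proof -
      have "matrix_power A (Suc ?\<nu> + j) *v x = 0"
        using that by (simp add: null_space_def)
      then have "matrix_power A j *v x \<in> null_space (matrix_power A (Suc ?\<nu>))"
        unfolding null_space_def matrix_power_add by (simp add: matrix_vector_mul_assoc)
      then have "matrix_power A j *v x \<in> null_space (matrix_power A ?\<nu>)"
        using null_space_Suc_matrix_index by blast
      then show ?thesis
        by (simp add: null_space_def matrix_power_add matrix_vector_mul_assoc)
    qed
    with Suc.IH show ?case by blast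
  qed simp
  moreover have "null_space (matrix_power A m) \<subseteq> null_space (matrix_power A (?\<nu> + m))"
    by (rule null_space_matrix_power_mono) simp
  ultimately show ?thesis by blast
qed

text \<open>Horner's rule for the action of \<open>p(B)\<close> on a vector. Every property of matrix polynomials
  below follows from it by an induction.\<close>

lemma poly_matrix_pCons:
  fixes B :: "'a::field^'n^'n"
  shows "poly_matrix (pCons a p) B *v x = a *s x + B *v (poly_matrix p B *v x)"
proof -
  have act: "poly_matrix r B *v x = (\<Sum>k\<le>n. coeff r k *s (matrix_power B k *v x))"
    if "degree r \<le> n" for r n
  proof -
    have scale: "map_matrix ((*) c) M *v x = c *s (M *v x)" for c and M :: "'a^'n^'n"
      by (simp add: vec_eq_iff matrix_vector_mult_def sum_distrib_left mult.assoc)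
    have "(sum f S :: 'a^'n^'n) *v x = (\<Sum>k\<in>S. f k *v x)" for f :: "nat \<Rightarrow> _" and S
      by (induction S rule: infinite_finite_induct) (simp_all add: matrix_vector_mult_add_rdistrib)
    then have "poly_matrix r B *v x = (\<Sum>k\<le>degree r. coeff r k *s (matrix_power B k *v x))"
      by (simp add: poly_matrix_def scale)
    also have "\<dots> = (\<Sum>k\<le>n. coeff r k *s (matrix_power B k *v x))"
      using that by (intro sum.mono_neutral_left) (auto simp: coeff_eq_0)
    finally show ?thesis .
  qed
  have "poly_matrix (pCons a p) B *v x
      = (\<Sum>k\<le>Suc (degree p). coeff (pCons a p) k *s (matrix_power B k *v x))"
    by (rule act) (simp add: degree_pCons_le)
  also have "\<dots> = a *s x + B *v (\<Sum>k\<le>degree p. coeff p k *s (matrix_power B k *v x))"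
    unfolding sum.atMost_Suc_shift
    by (simp add: vec.sum vec.scale matrix_vector_mul_assoc)
  finally show ?thesis
    by (simp add: act[OF order.refl])
qed

lemma poly_matrix_0: "poly_matrix 0 B *v x = 0"
  by (simp add: poly_matrix_def matrix_vector_mult_def vec_eq_iff)

lemma poly_matrix_smult:
  fixes B :: "'a::field^'n^'n"
  shows "poly_matrix (smult c p) B *v x = c *s (poly_matrix p B *v x)"
  by (induction p) (simp_all add: poly_matrix_0 poly_matrix_pCons vec.scale
      vector_add_ldistrib vector_smult_assoc)

lemma poly_matrix_monom_mult:
  fixes B :: "'a::field^'n^'n"
  shows "poly_matrix (monom 1 t * p) B *v x = matrix_power B t *v (poly_matrix p B *v x)"
  by (induction t) (simp_all add: monom_Suc poly_matrix_pCons flip: matrix_vector_mul_assoc)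

lemma poly_matrix_commute:
  fixes B C :: "'a::field^'n^'n"
  assumes "B ** C = C ** B"
  shows "C *v (poly_matrix p B *v x) = poly_matrix p B *v (C *v x)"
proof (induction p)
  case (pCons a p)
  have "C *v (B *v y) = B *v (C *v y)" for y
    by (simp add: matrix_vector_mul_assoc assms)
  with pCons show ?case
    by (simp add: poly_matrix_pCons matrix_vector_right_distrib vec.scale)
qed (simp add: poly_matrix_0)

text \<open>The two properties of \<open>h\<close> that matter are isolated here: its constant term, and that some
  \<open>\<lambda>\<^sup>t h(\<lambda>)\<close> annihilates \<open>A\<^sup>u\<close>.\<close>

lemma is_eigenprojection_poly_matrix:
  fixes A :: "complex^'n^'n"
  assumes u: "u \<ge> matrix_index A"
    and const: "coeff h 0 = 1"
    and annih: "\<And>x. matrix_power (matrix_power A u) t *v (poly_matrix h (matrix_power A u) *v x) = 0"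
  shows "is_eigenprojection A (poly_matrix h (matrix_power A u))"
proof -
  define B where "B = matrix_power A u"
  define Z where "Z = poly_matrix h B"
  define N where "N = matrix_power A (matrix_index A)"
  obtain g where "h = pCons 1 g"
    using const by (metis pCons_cases coeff_pCons_0)
  then have Z: "Z *v x = x + B *v (poly_matrix g B *v x)" for x
    by (simp add: Z_def poly_matrix_pCons)
  have comm: "matrix_power A m *v (poly_matrix p B *v x) = poly_matrix p B *v (matrix_power A m *v x)"
    for m p x
    by (rule poly_matrix_commute) (simp add: B_def add.commute flip: matrix_power_add)

  have NZ: "N *v (Z *v x) = 0" for x
  proof -
    have "Z *v x \<in> null_space (matrix_power A (u * t))"
      using annih by (simp add: null_space_def Z_def B_def matrix_power_mult)
    then have "Z *v x \<in> null_space N"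
      unfolding N_def using null_space_matrix_power_subset by blast
    then show ?thesis
      by (simp add: null_space_def)
  qed

  have fixed: "Z *v x = x" if "N *v x = 0" for x
  proof -
    have "B *v x = 0"
      using null_space_matrix_power_mono[OF u] that by (auto simp: null_space_def N_def B_def)
    then show ?thesis
      using Z comm[of u] by (simp add: B_def[symmetric])
  qed

  have "Z ** Z = Z"
    by (simp add: matrix_eq fixed NZ flip: matrix_vector_mul_assoc)
  moreover have "matrix_range Z = null_space N"
  proof
    show "matrix_range Z \<subseteq> null_space N"
      by (auto simp: matrix_range_def null_space_def NZ)
    show "null_space N \<subseteq> matrix_range Z"
      unfolding matrix_range_def null_space_def using fixed
      by (metis (mono_tags) mem_Collect_eq rangeI subsetI)
  qed
  moreover have "null_space Z = matrix_range N"
  proof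
    show "null_space Z \<subseteq> matrix_range N"
    proof
      fix x assume "x \<in> null_space Z"
      then have "x = B *v (- (poly_matrix g B *v x))"
        using Z[of x] by (simp add: null_space_def vec.neg eq_neg_iff_add_eq_0)
      moreover have "B = N ** matrix_power A (u - matrix_index A)"
        using u by (simp add: B_def N_def flip: matrix_power_add)
      ultimately show "x \<in> matrix_range N"
        unfolding matrix_range_def by (metis matrix_vector_mul_assoc rangeI)
    qed
    \<comment> \<open>\<open>Z\<close> commutes with \<open>N\<close>, so \<open>N Z = 0\<close> also gives \<open>Z N = 0\<close>.\<close>
    show "matrix_range N \<subseteq> null_space Z"
    proof -
      have "Z *v (N *v y) = 0" for y
        using NZ[of y] comm[of "matrix_index A" h y] by (simp add: Z_def N_def)
      then show ?thesis
        by (auto simp: matrix_range_def null_space_def)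
    qed
  qed
  ultimately show ?thesis
    by (simp add: is_eigenprojection_def Z_def B_def N_def)
qed

theorem theorem1:
  fixes A :: "complex^'n^'n"
    and u t q :: nat
    and p :: "nat \<Rightarrow> complex"
    and \<phi> \<psi> h :: "complex poly"
  assumes "u \<ge> matrix_index A"
    and "\<phi> \<noteq> 0"
    and "poly_matrix \<phi> (matrix_power A u) = 0"
    and "p 0 = 1"
    and "p q \<noteq> 0"
    and "\<psi> = (\<Sum>i\<le>q. monom (p i) (q - i))"
    and "\<phi> = monom 1 t * \<psi>"
    and "h = smult (inverse (p q)) \<psi>"
  shows "is_eigenprojection A (poly_matrix h (matrix_power A u))"
proof (rule is_eigenprojection_poly_matrix)
  show "u \<ge> matrix_index A" by fact
  have "coeff \<psi> 0 = (\<Sum>i\<le>q. if i = q then p i else 0)"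
    unfolding assms(6) coeff_sum by (rule sum.cong) auto
  then show "coeff h 0 = 1"
    using assms(5,8) by simp
  show "matrix_power (matrix_power A u) t *v (poly_matrix h (matrix_power A u) *v x) = 0" for x
    using assms(3) unfolding assms(7,8)
    by (simp add: poly_matrix_smult vec.scale flip: poly_matrix_monom_mult)
qed

end
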